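(* Let $V$ be the value function of the reflected optimal stopping problem described in the context, $G(x_1,x_2)=x_1\vee\alpha x_2$, $H:=V-G\ge0$, $\mathcal D:=\{V=G\}$ and $\mathcal C:=\{V>G\}$. Assume that $V$ is continuous on $\mathbb R_+^2$ and that (M1) for every $x_1\ge0$, the map $x_2\mapsto H(x_1,x_2)$ is nonincreasing on $[0,\infty)$; (M2) for every $x_1\ge0$, the vertical section $\mathcal D(x_1):=\{x_2\ge0:(x_1,x_2)\in\mathcal D\}$ is nonempty. Define $b(x_1):=\inf\{x_2\ge0:(x_1,x_2)\in\mathcal D\}$ for $x_1\ge0$. Then $b$ is well defined with values in $[0,\infty)$, and $$\mathcal D=\{(x_1,x_2)\in\mathbb R_+^2:x_2\ge b(x_1)\},\qquad \mathcal C=\{(x_1,x_2)\in\mathbb R_+^2:x_2<b(x_1)\}.$$ If, in addition, (M3) for every $x_2\ge0$ the map $x_1\mapsto H(x_1,x_2)$ is monotone on $[0,\infty)$, with a direction independent of $x_2$ (either nonincreasing for all $x_2$ or nondecreasing for all $x_2$), then $b$ is monotone: if the maps $x_1\mapsto H(x_1,x_2)$ are nonincreasing, then $b$ is nonincreasing; if they are nondecreasing, then $b$ is nondecreasing.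
   Context: Setting. $\mathbb R_+^2=[0,\infty)^2$, $\mathbb R_{++}^2=(0,\infty)^2$. On a filtered probability space satisfying the usual conditions, $W$ is a two-dimensional Brownian motion and, for $x\in\mathbb R_+^2$, $X=X^x$ solves $X_t=x+\int_0^t\mu(X_s)ds+\int_0^t\sigma(X_s)dW_s+L_t$ with values in $\mathbb R_+^2$, where $L=(L^1,L^2)$, each $L^i$ is continuous, nondecreasing, $L^i_0=0$ and $\int_0^\infty\mathbf 1_{\{X^i_t>0\}}dL^i_t=0$. Put $a=\sigma\sigma^\top$. Standing assumptions: (A1) $\mu,\sigma$ are locally Lipschitz with at most linear growth on $\mathbb R_+^2$. (A2) $a$ is locally uniformly elliptic in $\mathbb R_{++}^2$. (A3) For every $x$ the reflected SDE has a unique strong solution and the family $(X^x)$ is strong Markov. (A4) For every $T>0$, compact $K\subset\mathbb R_+^2$ and some $q\ge1$: $\lim_{y\to x}\mathbb E[\sup_{t\le T}|X^y_t-X^x_t|^q]=0$ for $x\in K$. (A5) $r>0$, $\alpha>0$, $c:\mathbb R_+^2\to[0,\infty)$ continuous. (A6) $V$ below is finite with $0\le V(x)\le C_V(1+|x|^p)$ for some $C_V>0$, $p\ge1$, and the discounted payoff and running-cost terms are integrable for the stopping times considered. Value function. $V(x)=\sup_{\tau\in\mathcal T}\mathbb E_x[e^{-r\tau}G(X_\tau)-\int_0^\tau e^{-rs}c(X_s)ds]$, where $\mathcal T$ is the set of all $[0,\infty]$-valued stopping times and $e^{-r\tau}G(X_\tau):=0$ on $\{\tau=\infty\}$. Taking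 $\tau=0$ shows $V\ge G$. *)

theory Defs
  imports "HOL-Probability.Probability"
begin

section \<open>State space and coefficient conditions\<close>

definition quadrant :: "(real^2) set" where
  "quadrant = {x. \<forall>i. 0 \<le> x $ i}"

definition open_quadrant :: "(real^2) set" where
  "open_quadrant = {x. \<forall>i. 0 < x $ i}"

definition locally_lipschitz_on :: "'a::metric_space set \<Rightarrow> ('a \<Rightarrow> 'b::metric_space) \<Rightarrow> bool" where
  "locally_lipschitz_on S f \<longleftrightarrow> (\<forall>x\<in>S. \<exists>u>0. \<exists>L. L-lipschitz_on (cball x u \<inter> S) f)"

definition linear_growth_on :: "'a::real_normed_vector set \<Rightarrow> ('a \<Rightarrow> 'b::real_normed_vector) \<Rightarrow> bool" where
  "linear_growth_on S f \<longleftrightarrow> (\<exists>C. \<forall>x\<in>S. norm (f x) \<le> C * (1 + norm x))"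

definition locally_uniformly_elliptic_on :: "(real^'n) set \<Rightarrow> (real^'n \<Rightarrow> real^'n^'n) \<Rightarrow> bool" where
  "locally_uniformly_elliptic_on S a \<longleftrightarrow>
     (\<forall>K. compact K \<and> K \<subseteq> S \<longrightarrow>
        (\<exists>\<kappa>>0. \<forall>x\<in>K. \<forall>\<xi>. \<kappa> * (norm \<xi>)\<^sup>2 \<le> \<xi> \<bullet> (a x *v \<xi>)))"


section \<open>Filtered probability space and Brownian motion\<close>

text \<open>
  Processes are indexed by \<^typ>\<open>real\<close>, and only times \<open>t \<ge> 0\<close> matter. Filtrations are indexed by
  \<^typ>\<open>ennreal\<close>, with \<open>F \<infinity>\<close> generated by the \<open>F t\<close>, \<open>t < \<infinity>\<close>. The library notion
  \<^const>\<open>stopping_time\<close> then covers exactly the \<open>[0,\<infinity>]\<close>-valued stopping times: its condition at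
  \<open>t = \<infinity>\<close> is trivial.
\<close>

definition usual_conditions :: "'a measure \<Rightarrow> (ennreal \<Rightarrow> 'a measure) \<Rightarrow> bool" where
  "usual_conditions M F \<longleftrightarrow>
     prob_space M \<and> complete_measure M \<and> filtration (space M) F \<and>
     (\<forall>t. subalgebra M (F t)) \<and>
     null_sets M \<subseteq> sets (F 0) \<and>
     (\<forall>t<\<infinity>. sets (F t) = (\<Inter>s\<in>{t<..}. sets (F s))) \<and>
     sets (F \<infinity>) = sigma_sets (space M) (\<Union>t\<in>{..<\<infinity>}. sets (F t))"

definition adapted :: "(ennreal \<Rightarrow> 'a measure) \<Rightarrow> (real \<Rightarrow> 'a \<Rightarrow> 'b::topological_space) \<Rightarrow> bool" where
  "adapted F Y \<longleftrightarrow> (\<forall>t\<ge>0. Y t \<in> borel_measurable (F (ennreal t)))"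

definition brownian_motion ::
    "'a measure \<Rightarrow> (ennreal \<Rightarrow> 'a measure) \<Rightarrow> (real \<Rightarrow> 'a \<Rightarrow> real^'n) \<Rightarrow> bool" where
  "brownian_motion M F W \<longleftrightarrow>
     adapted F W \<and>
     (AE \<omega> in M. W 0 \<omega> = 0 \<and> continuous_on {0..} (\<lambda>t. W t \<omega>)) \<and>
     (\<forall>s t. 0 \<le> s \<and> s < t \<longrightarrow>
        distributed M lborel (\<lambda>\<omega>. W t \<omega> - W s \<omega>)
          (\<lambda>x. ennreal (\<Prod>i\<in>UNIV. normal_density 0 (sqrt (t - s)) (x $ i))) \<and>
        prob_space.indep_set M (sets (F (ennreal s)))
          {(\<lambda>\<omega>. W t \<omega> - W s \<omega>) -` B \<inter> space M | B. B \<in> sets borel})"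

text \<open>The natural filtration of \<open>W\<close>, augmented by all null sets.\<close>

definition augmented_filtration ::
    "'a measure \<Rightarrow> (real \<Rightarrow> 'a \<Rightarrow> 'b::topological_space) \<Rightarrow> ennreal \<Rightarrow> 'a measure" where
  "augmented_filtration M W t = sigma (space M)
     ({W s -` B \<inter> space M | s B. 0 \<le> s \<and> ennreal s \<le> t \<and> B \<in> sets borel} \<union> null_sets M)"


section \<open>Ito integral\<close>

definition tendsto_zero_in_prob :: "'a measure \<Rightarrow> (nat \<Rightarrow> 'a \<Rightarrow> ennreal) \<Rightarrow> bool" where
  "tendsto_zero_in_prob M Z \<longleftrightarrow>
     (\<forall>k. Z k \<in> borel_measurable M) \<and>
     (\<forall>\<epsilon>>0. (\<lambda>k. measure M {\<omega>\<in>space M. ennreal \<epsilon> < Z k \<omega>}) \<longlonglongrightarrow> 0)"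

text \<open>
  A simple integrand is \<open>\<Sum>i<n. \<xi> i * 1\<^bsub>(t i, t (i + 1)]\<^esub>\<close> with \<open>\<xi> i\<close> bounded and
  \<open>F (t i)\<close>-measurable.
\<close>

definition simple_integrand ::
    "'a measure \<Rightarrow> (ennreal \<Rightarrow> 'a measure) \<Rightarrow> nat \<Rightarrow> (nat \<Rightarrow> real) \<Rightarrow> (nat \<Rightarrow> 'a \<Rightarrow> real) \<Rightarrow> bool" where
  "simple_integrand M F n t \<xi> \<longleftrightarrow>
     0 \<le> t 0 \<and> (\<forall>i<n. t i \<le> t (Suc i)) \<and>
     (\<forall>i<n. \<xi> i \<in> borel_measurable (F (ennreal (t i))) \<and> bounded (\<xi> i ` space M))"

definition simple_value :: "nat \<Rightarrow> (nat \<Rightarrow> real) \<Rightarrow> (nat \<Rightarrow> 'a \<Rightarrow> real) \<Rightarrow> real \<Rightarrow> 'a \<Rightarrow> real" where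
  "simple_value n t \<xi> s \<omega> = (\<Sum>i<n. \<xi> i \<omega> * indicator {t i<..t (Suc i)} s)"

definition simple_integral ::
    "(real \<Rightarrow> 'a \<Rightarrow> real) \<Rightarrow> nat \<Rightarrow> (nat \<Rightarrow> real) \<Rightarrow> (nat \<Rightarrow> 'a \<Rightarrow> real) \<Rightarrow> real \<Rightarrow> 'a \<Rightarrow> real" where
  "simple_integral B n t \<xi> s \<omega> =
     (\<Sum>i<n. \<xi> i \<omega> * (B (min (t (Suc i)) s) \<omega> - B (min (t i) s) \<omega>))"

text \<open>
  \<open>I t = \<integral>\<^sub>0\<^sup>t H s dB s\<close>: the usual extension by continuity, where \<open>H\<close> is approximated by simple
  integrands in \<open>L\<^sup>2[0,T]\<close> in probability, and the integrals converge uniformly on \<open>[0,T]\<close> in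
  probability.
\<close>

definition is_ito_integral ::
    "'a measure \<Rightarrow> (ennreal \<Rightarrow> 'a measure) \<Rightarrow> (real \<Rightarrow> 'a \<Rightarrow> real) \<Rightarrow> (real \<Rightarrow> 'a \<Rightarrow> real)
      \<Rightarrow> (real \<Rightarrow> 'a \<Rightarrow> real) \<Rightarrow> bool" where
  "is_ito_integral M F B H I \<longleftrightarrow>
     adapted F I \<and>
     (AE \<omega> in M. I 0 \<omega> = 0 \<and> continuous_on {0..} (\<lambda>t. I t \<omega>)) \<and>
     (\<exists>n t \<xi>. (\<forall>k. simple_integrand M F (n k) (t k) (\<xi> k)) \<and>
        (\<forall>T>0.
           tendsto_zero_in_prob M (\<lambda>k \<omega>.
             \<integral>\<^sup>+s\<in>{0..T}. ennreal ((simple_value (n k) (t k) (\<xi> k) s \<omega> - H s \<omega>)\<^sup>2) \<partial>lborel) \<and>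
           tendsto_zero_in_prob M (\<lambda>k \<omega>.
             SUP s\<in>{0..T}. ennreal \<bar>simple_integral B (n k) (t k) (\<xi> k) s \<omega> - I s \<omega>\<bar>)))"

definition is_ito_integral_matrix ::
    "'a measure \<Rightarrow> (ennreal \<Rightarrow> 'a measure) \<Rightarrow> (real \<Rightarrow> 'a \<Rightarrow> real^'n) \<Rightarrow> (real \<Rightarrow> 'a \<Rightarrow> real^'n^'m)
      \<Rightarrow> (real \<Rightarrow> 'a \<Rightarrow> real^'m) \<Rightarrow> bool" where
  "is_ito_integral_matrix M F W S I \<longleftrightarrow>
     (\<exists>J. (\<forall>i j. is_ito_integral M F (\<lambda>t \<omega>. W t \<omega> $ j) (\<lambda>t \<omega>. S t \<omega> $ i $ j) (J i j)) \<and>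
          (\<forall>t \<omega>. I t \<omega> = (\<chi> i. \<Sum>j\<in>UNIV. J i j t \<omega>)))"


section \<open>The reflected equation\<close>

text \<open>
  The measure \<open>dL\<^sup>i\<close> is the Stieltjes measure of the path extended by its value at \<open>0\<close> to negative
  times, so the last clause below is \<open>\<integral>\<^sub>0\<^sup>\<infinity> 1\<^bsub>{X\<^sup>i > 0}\<^esub> dL\<^sup>i = 0\<close>.
\<close>

definition reflected_solution ::
    "'a measure \<Rightarrow> (ennreal \<Rightarrow> 'a measure) \<Rightarrow> (real \<Rightarrow> 'a \<Rightarrow> real^2) \<Rightarrow> (real^2 \<Rightarrow> real^2)
      \<Rightarrow> (real^2 \<Rightarrow> real^2^2) \<Rightarrow> real^2 \<Rightarrow> (real \<Rightarrow> 'a \<Rightarrow> real^2) \<Rightarrow> (real \<Rightarrow> 'a \<Rightarrow> real^2) \<Rightarrow> bool" where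
  "reflected_solution M F W \<mu> \<sigma> x X L \<longleftrightarrow>
     adapted F X \<and> adapted F L \<and>
     (AE \<omega> in M. continuous_on {0..} (\<lambda>t. X t \<omega>) \<and> (\<forall>t\<ge>0. X t \<omega> \<in> quadrant)) \<and>
     (\<exists>I. is_ito_integral_matrix M F W (\<lambda>s \<omega>. \<sigma> (X s \<omega>)) I \<and>
        (AE \<omega> in M. \<forall>t\<ge>0.
           X t \<omega> = x + integral {0..t} (\<lambda>s. \<mu> (X s \<omega>)) + I t \<omega> + L t \<omega>)) \<and>
     (AE \<omega> in M. \<forall>i.
        continuous_on {0..} (\<lambda>t. L t \<omega> $ i) \<and> mono_on {0..} (\<lambda>t. L t \<omega> $ i) \<and> L 0 \<omega> $ i = 0 \<and>
        (\<integral>\<^sup>+t. indicator {t. 0 \<le> t \<and> 0 < X t \<omega> $ i} t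
           \<partial>interval_measure (\<lambda>t. L (max 0 t) \<omega> $ i)) = 0)"

text \<open>Adapted to the filtration of \<open>W\<close>, and unique up to indistinguishability.\<close>

definition unique_strong_solution ::
    "'a measure \<Rightarrow> (ennreal \<Rightarrow> 'a measure) \<Rightarrow> (real \<Rightarrow> 'a \<Rightarrow> real^2) \<Rightarrow> (real^2 \<Rightarrow> real^2)
      \<Rightarrow> (real^2 \<Rightarrow> real^2^2) \<Rightarrow> real^2 \<Rightarrow> (real \<Rightarrow> 'a \<Rightarrow> real^2) \<Rightarrow> bool" where
  "unique_strong_solution M F W \<mu> \<sigma> x X \<longleftrightarrow>
     (\<exists>L. reflected_solution M F W \<mu> \<sigma> x X L \<and>
          adapted (augmented_filtration M W) X \<and> adapted (augmented_filtration M W) L) \<and>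
     (\<forall>X' L'. reflected_solution M F W \<mu> \<sigma> x X' L' \<longrightarrow>
        (AE \<omega> in M. \<forall>t\<ge>0. X' t \<omega> = X t \<omega>))"

text \<open>
  On \<open>{\<tau> < \<infinity>}\<close>: \<open>E[f (X\<^sup>x (\<tau> + t)) | F \<tau>] = P\<^sub>t f (X\<^sup>x \<tau>)\<close> a.s., where \<open>P\<^sub>t f y = E[f (X\<^sup>y t)]\<close>.
\<close>

definition strong_markov_family ::
    "'a measure \<Rightarrow> (ennreal \<Rightarrow> 'a measure) \<Rightarrow> (real^2 \<Rightarrow> real \<Rightarrow> 'a \<Rightarrow> real^2) \<Rightarrow> bool" where
  "strong_markov_family M F X \<longleftrightarrow>
     (\<forall>f::real^2 \<Rightarrow> real. f \<in> borel_measurable borel \<and> bounded (range f) \<longrightarrow> (\<forall>t\<ge>0.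
        (\<lambda>y. \<integral>\<omega>. f (X y t \<omega>) \<partial>M) \<in> borel_measurable (restrict_space borel quadrant) \<and>
        (\<forall>x\<in>quadrant. \<forall>\<tau>. stopping_time F \<tau> \<longrightarrow>
           (AE \<omega> in M.
              real_cond_exp M (filtration.pre_sigma (space M) F \<tau>)
                (\<lambda>\<omega>. if \<tau> \<omega> < \<infinity> then f (X x (enn2real (\<tau> \<omega>) + t) \<omega>) else 0) \<omega>
              = (if \<tau> \<omega> < \<infinity> then \<integral>\<omega>'. f (X (X x (enn2real (\<tau> \<omega>)) \<omega>) t \<omega>') \<partial>M else 0)))))"


section \<open>The stopping problem\<close>

definition payoff :: "real \<Rightarrow> real^2 \<Rightarrow> real" where
  "payoff \<alpha> x = max (x $ 1) (\<alpha> * x $ 2)"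

definition discounted_payoff ::
    "(real^2 \<Rightarrow> real \<Rightarrow> 'a \<Rightarrow> real^2) \<Rightarrow> real \<Rightarrow> real \<Rightarrow> real^2 \<Rightarrow> ('a \<Rightarrow> ennreal) \<Rightarrow> 'a \<Rightarrow> real" where
  "discounted_payoff X r \<alpha> x \<tau> \<omega> =
     (if \<tau> \<omega> = \<infinity> then 0
      else exp (- r * enn2real (\<tau> \<omega>)) * payoff \<alpha> (X x (enn2real (\<tau> \<omega>)) \<omega>))"

definition running_cost ::
    "(real^2 \<Rightarrow> real \<Rightarrow> 'a \<Rightarrow> real^2) \<Rightarrow> real \<Rightarrow> (real^2 \<Rightarrow> real) \<Rightarrow> real^2 \<Rightarrow> ('a \<Rightarrow> ennreal) \<Rightarrow> 'a \<Rightarrow> ennreal"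
  where
  "running_cost X r c x \<tau> \<omega> =
     (\<integral>\<^sup>+s\<in>{s. 0 \<le> s \<and> ennreal s \<le> \<tau> \<omega>}. ennreal (exp (- r * s) * c (X x s \<omega>)) \<partial>lborel)"

definition expected_reward ::
    "'a measure \<Rightarrow> (real^2 \<Rightarrow> real \<Rightarrow> 'a \<Rightarrow> real^2) \<Rightarrow> real \<Rightarrow> real \<Rightarrow> (real^2 \<Rightarrow> real)
      \<Rightarrow> real^2 \<Rightarrow> ('a \<Rightarrow> ennreal) \<Rightarrow> real" where
  "expected_reward M X r \<alpha> c x \<tau> =
     (\<integral>\<omega>. discounted_payoff X r \<alpha> x \<tau> \<omega> - enn2real (running_cost X r c x \<tau> \<omega>) \<partial>M)"

definition value_function ::
    "'a measure \<Rightarrow> (ennreal \<Rightarrow> 'a measure) \<Rightarrow> (real^2 \<Rightarrow> real \<Rightarrow> 'a \<Rightarrow> real^2) \<Rightarrow> real \<Rightarrow> real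
      \<Rightarrow> (real^2 \<Rightarrow> real) \<Rightarrow> real^2 \<Rightarrow> ereal" where
  "value_function M F X r \<alpha> c x =
     (SUP \<tau>\<in>{\<tau>. stopping_time F \<tau>}. ereal (expected_reward M X r \<alpha> c x \<tau>))"

locale reflected_stopping_problem =
  fixes M :: "'a measure" and F :: "ennreal \<Rightarrow> 'a measure"
    and W :: "real \<Rightarrow> 'a \<Rightarrow> real^2"
    and X :: "real^2 \<Rightarrow> real \<Rightarrow> 'a \<Rightarrow> real^2"
    and \<mu> :: "real^2 \<Rightarrow> real^2" and \<sigma> :: "real^2 \<Rightarrow> real^2^2"
    and r \<alpha> :: real and c :: "real^2 \<Rightarrow> real"
  assumes usual: "usual_conditions M F"
    and brownian: "brownian_motion M F W"
    and lipschitz: "locally_lipschitz_on quadrant \<mu>" "locally_lipschitz_on quadrant \<sigma>"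
    and growth: "linear_growth_on quadrant \<mu>" "linear_growth_on quadrant \<sigma>"
    and elliptic: "locally_uniformly_elliptic_on open_quadrant (\<lambda>x. \<sigma> x ** transpose (\<sigma> x))"
    and solution: "\<And>x. x \<in> quadrant \<Longrightarrow> unique_strong_solution M F W \<mu> \<sigma> x (X x)"
    and strong_markov: "strong_markov_family M F X"
    and stable: "\<And>T K. 0 < T \<Longrightarrow> compact K \<Longrightarrow> K \<subseteq> quadrant \<Longrightarrow>
      \<exists>q\<ge>1. \<forall>x\<in>K.
        ((\<lambda>y. \<integral>\<^sup>+\<omega>. (SUP t\<in>{0..T}. ennreal (norm (X y t \<omega> - X x t \<omega>) powr q)) \<partial>M) \<longlongrightarrow> 0)
          (at x within quadrant)"
    and r_pos: "0 < r" and \<alpha>_pos: "0 < \<alpha>"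
    and c_continuous: "continuous_on quadrant c"
    and c_nonneg: "\<And>x. x \<in> quadrant \<Longrightarrow> 0 \<le> c x"
    and value_bounds: "\<exists>C p. 0 < C \<and> 1 \<le> p \<and> (\<forall>x\<in>quadrant.
      0 \<le> value_function M F X r \<alpha> c x \<and>
      value_function M F X r \<alpha> c x \<le> ereal (C * (1 + norm x powr p)))"
    and payoff_integrable: "\<And>x \<tau>. x \<in> quadrant \<Longrightarrow> stopping_time F \<tau> \<Longrightarrow>
      integrable M (discounted_payoff X r \<alpha> x \<tau>)"
    and cost_finite: "\<And>x \<tau>. x \<in> quadrant \<Longrightarrow> stopping_time F \<tau> \<Longrightarrow>
      AE \<omega> in M. running_cost X r c x \<tau> \<omega> < \<infinity>"
    and cost_integrable: "\<And>x \<tau>. x \<in> quadrant \<Longrightarrow> stopping_time F \<tau> \<Longrightarrow>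
      integrable M (\<lambda>\<omega>. enn2real (running_cost X r c x \<tau> \<omega>))"

end

theory Submission
  imports Defs
begin

text \<open>
  Stopping immediately gives \<open>V \<ge> G\<close>, so the stopping set is the zero set of \<open>H \<ge> 0\<close>. On each
  vertical section, \<open>H\<close> is continuous and nonincreasing, so its zero set is a closed up-set,
  hence the half line starting at its infimum. If \<open>H\<close> is monotone in \<open>x\<^sub>1\<close>, these
  half lines are nested.
\<close>

text \<open>The zeros of a nonnegative nonincreasing \<open>h\<close> form an up-set, and continuity
  makes the infimum itself a zero. The infimum is taken in \<open>ereal\<close>, so an empty zero
  set gives \<infinity> and both sides are false without a case split.\<close>

lemma INF_zeros_le_iff:
  fixes h :: "real \<Rightarrow> real"
  assumes cont: "continuous_on {0..} h" and anti: "antimono_on {0..} h"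
    and nonneg: "\<And>y. 0 \<le> y \<Longrightarrow> 0 \<le> h y" and x: "0 \<le> x"
  shows "(INF y\<in>{y. 0 \<le> y \<and> h y = 0}. ereal y) \<le> ereal x \<longleftrightarrow> h x = 0"
proof
  assume "h x = 0"
  with x show "(INF y\<in>{y. 0 \<le> y \<and> h y = 0}. ereal y) \<le> ereal x"
    by (intro INF_lower) auto
next
  assume le: "(INF y\<in>{y. 0 \<le> y \<and> h y = 0}. ereal y) \<le> ereal x"
  show "h x = 0"
  proof (rule ccontr)
    assume "h x \<noteq> 0"
    with nonneg[OF x] have pos: "0 < h x" by simp
    \<comment> \<open>Taking the tolerance to be \<open>h x\<close> itself keeps \<open>h\<close>
      nonzero within distance \<open>d\<close> of \<open>x\<close>.\<close>
    from cont x pos obtain d where d: "0 < d"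
      and near: "\<And>y. 0 \<le> y \<Longrightarrow> dist y x < d \<Longrightarrow> dist (h y) (h x) < h x"
      unfolding continuous_on_iff by (metis atLeast_iff)
    have "ereal (x + d) \<le> (INF y\<in>{y. 0 \<le> y \<and> h y = 0}. ereal y)"
    proof (rule INF_greatest)
      fix y assume "y \<in> {y. 0 \<le> y \<and> h y = 0}"
      then have y: "0 \<le> y" "h y = 0" by auto
      \<comment> \<open>A zero at or left of \<open>x\<close> would force
        \<open>h x \<le> 0\<close>, so all zeros lie to the right of \<open>x\<close>, and by the
        choice of \<open>d\<close> at distance at least \<open>d\<close>.\<close>
      have "x < y"
        using monotone_onD[OF anti, of y x] x y pos by force
      moreover have "d \<le> dist y x"
        using near[of y] y by (force simp: dist_real_def)
      ultimately show "ereal (x + d) \<le> ereal y"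
        by (simp add: dist_real_def)
    qed
    then have "ereal (x + d) \<le> ereal x"
      using le by (rule order_trans)
    with d show False by simp
  qed
qed

lemma vector_2_in_quadrant: "0 \<le> a \<Longrightarrow> 0 \<le> b \<Longrightarrow> vector [a, b] \<in> quadrant"
  by (simp add: quadrant_def forall_2)

lemma vector_2_eta: "vector [x $ 1, x $ 2] = (x :: real^2)"
  by (simp add: vec_eq_iff forall_2)

lemma continuous_on_vector_2: "continuous_on S (\<lambda>y. vector [a, y] :: real^2)"
proof -
  have "(\<lambda>y. vector [a, y] :: real^2) = (\<lambda>y. \<chi> i. if i = 1 then a else y)"
    by (auto simp: vec_eq_iff forall_2)
  moreover have "continuous_on S (\<lambda>y. (\<chi> i. if i = 1 then a else y) :: real^2)"
    by (intro continuous_on_vec_lambda) (case_tac "i = 1"; simp)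
  ultimately show ?thesis by (simp only:)
qed

lemma continuous_on_payoff: "continuous_on S (payoff \<alpha>)"
  unfolding payoff_def[abs_def] by (intro continuous_intros)

text \<open>At time 0 the drift integral runs over a single point, and both the Ito integral and
  \<open>L\<close> start at 0 almost surely.\<close>

lemma reflected_solution_initial:
  assumes "reflected_solution M F W \<mu> \<sigma> x X L"
  shows "AE \<omega> in M. X 0 \<omega> = x"
proof -
  obtain I where I: "is_ito_integral_matrix M F W (\<lambda>s \<omega>. \<sigma> (X s \<omega>)) I"
    and eq: "AE \<omega> in M. \<forall>t\<ge>0. X t \<omega> = x + integral {0..t} (\<lambda>s. \<mu> (X s \<omega>)) + I t \<omega> + L t \<omega>"
    using assms unfolding reflected_solution_def by blast
  obtain J where J: "\<And>i j. is_ito_integral M F (\<lambda>t \<omega>. W t \<omega> $ j) (\<lambda>t \<omega>. \<sigma> (X t \<omega>) $ i $ j) (J i j)"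
    and IJ: "\<And>t \<omega>. I t \<omega> = (\<chi> i. \<Sum>j\<in>UNIV. J i j t \<omega>)"
    using I unfolding is_ito_integral_matrix_def by blast
  have J0: "AE \<omega> in M. J i j 0 \<omega> = 0" for i j
    using J[of j i] unfolding is_ito_integral_def by (auto elim: eventually_mono)
  have "AE \<omega> in M. \<forall>i j. J i j 0 \<omega> = 0"
    unfolding eventually_all_finite by (simp add: AE_all_countable J0)
  moreover have "AE \<omega> in M. \<forall>i. L 0 \<omega> $ i = 0"
    using assms unfolding reflected_solution_def by (auto elim: eventually_mono)
  ultimately show ?thesis
    using eq by eventually_elim (auto simp: IJ vec_eq_iff)
qed

text \<open>The time interval degenerates to the single point 0, where the integrand may be nonzero
  but Lebesgue measure vanishes.\<close>

lemma running_cost_at_zero: "running_cost X r c x (\<lambda>_. 0) \<omega> = 0"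
proof -
  have "{s::real. 0 \<le> s \<and> ennreal s \<le> 0} = {0}"
    by auto
  then have "running_cost X r c x (\<lambda>_. 0) \<omega>
      = (\<integral>\<^sup>+s. ennreal (exp (- r * s) * c (X x s \<omega>)) * indicator {0} s \<partial>lborel)"
    unfolding running_cost_def by simp
  also have "\<dots> = (\<integral>\<^sup>+s. 0 \<partial>(lborel :: real measure))"
    by (intro nn_integral_cong_AE eventually_mono[OF AE_lborel_singleton[of 0]]) simp
  finally show ?thesis by simp
qed

lemma (in reflected_stopping_problem) value_function_ge_payoff:
  assumes x: "x \<in> quadrant"
  shows "ereal (payoff \<alpha> x) \<le> value_function M F X r \<alpha> c x"
proof -
  interpret prob_space M
    using usual by (simp add: usual_conditions_def)
  interpret filtration "space M" F
    using usual by (simp add: usual_conditions_def)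
  have stop: "stopping_time F (\<lambda>_. 0)"
    by (rule stopping_time_const)
  obtain L where "reflected_solution M F W \<mu> \<sigma> x (X x) L"
    using solution[OF x] unfolding unique_strong_solution_def by blast
  then have "AE \<omega> in M. X x 0 \<omega> = x"
    by (rule reflected_solution_initial)
  then have "AE \<omega> in M. discounted_payoff X r \<alpha> x (\<lambda>_. 0) \<omega> = payoff \<alpha> x"
    by eventually_elim (simp add: discounted_payoff_def)
  \<comment> \<open>The payoff equals the constant only almost surely, so comparing the integrals
    requires its measurability, which the integrability assumption supplies.\<close>
  then have "(\<integral>\<omega>. discounted_payoff X r \<alpha> x (\<lambda>_. 0) \<omega> \<partial>M) = (\<integral>\<omega>. payoff \<alpha> x \<partial>M)"
    by (intro integral_cong_AE borel_measurable_integrable[OF payoff_integrable[OF x stop]]) simp_all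
  then have "expected_reward M X r \<alpha> c x (\<lambda>_. 0) = payoff \<alpha> x"
    by (simp add: expected_reward_def running_cost_at_zero prob_space)
  then show ?thesis
    unfolding value_function_def using stop by (intro SUP_upper2[of "\<lambda>_. 0"]) auto
qed

theorem theorem3p7:
  fixes M :: "'a measure" and F :: "ennreal \<Rightarrow> 'a measure"
    and W :: "real \<Rightarrow> 'a \<Rightarrow> real^2" and X :: "real^2 \<Rightarrow> real \<Rightarrow> 'a \<Rightarrow> real^2"
    and \<mu> :: "real^2 \<Rightarrow> real^2" and \<sigma> :: "real^2 \<Rightarrow> real^2^2"
    and r \<alpha> :: real and c :: "real^2 \<Rightarrow> real"
    and V H :: "real^2 \<Rightarrow> real" and D C :: "(real^2) set" and b :: "real \<Rightarrow> ereal"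
  assumes problem: "reflected_stopping_problem M F W X \<mu> \<sigma> r \<alpha> c"
    and V: "\<And>x. x \<in> quadrant \<Longrightarrow> ereal (V x) = value_function M F X r \<alpha> c x"
    and H: "\<And>x. x \<in> quadrant \<Longrightarrow> H x = V x - payoff \<alpha> x"
    and D: "D = {x \<in> quadrant. V x = payoff \<alpha> x}"
    and C: "C = {x \<in> quadrant. V x > payoff \<alpha> x}"
    and b: "\<And>x1. 0 \<le> x1 \<Longrightarrow> b x1 = (INF x2\<in>{x2. 0 \<le> x2 \<and> vector [x1, x2] \<in> D}. ereal x2)"
    and V_continuous: "continuous_on quadrant V"
    and M1: "\<And>x1. 0 \<le> x1 \<Longrightarrow> antimono_on {0..} (\<lambda>x2. H (vector [x1, x2]))"
    and M2: "\<And>x1. 0 \<le> x1 \<Longrightarrow> {x2. 0 \<le> x2 \<and> vector [x1, x2] \<in> D} \<noteq> {}"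
  shows "(\<forall>x1\<ge>0. 0 \<le> b x1 \<and> b x1 < \<infinity>) \<and>
    D = {x \<in> quadrant. b (x $ 1) \<le> ereal (x $ 2)} \<and>
    C = {x \<in> quadrant. ereal (x $ 2) < b (x $ 1)} \<and>
    ((\<forall>x2\<ge>0. antimono_on {0..} (\<lambda>x1. H (vector [x1, x2]))) \<longrightarrow> antimono_on {0..} b) \<and>
    ((\<forall>x2\<ge>0. mono_on {0..} (\<lambda>x1. H (vector [x1, x2]))) \<longrightarrow> mono_on {0..} b)"
proof -
  interpret reflected_stopping_problem M F W X \<mu> \<sigma> r \<alpha> c
    by (rule problem)
  have H_nonneg: "0 \<le> H x" if "x \<in> quadrant" for x
    using value_function_ge_payoff[OF that] by (simp add: H that flip: V)
  have D_iff: "x \<in> D \<longleftrightarrow> H x = 0" if "x \<in> quadrant" for x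
    using that by (auto simp: D H)
  \<comment> \<open>Since \<open>H \<ge> 0\<close>, a point outside the stopping set has strictly
    positive \<open>H\<close>.\<close>
  have C_eq: "C = quadrant - D"
    using H_nonneg by (force simp: C D H)
  have b_eq: "b x1 = (INF x2\<in>{x2. 0 \<le> x2 \<and> H (vector [x1, x2]) = 0}. ereal x2)"
    if "0 \<le> x1" for x1
    unfolding b[OF that] using that
    by (intro arg_cong[where f = Inf] image_cong) (auto simp: D_iff vector_2_in_quadrant)
  have "continuous_on quadrant (\<lambda>x. V x - payoff \<alpha> x)"
    by (intro continuous_on_diff V_continuous continuous_on_payoff)
  then have H_cont: "continuous_on quadrant H"
    by (rule continuous_on_eq) (simp add: H)
  \<comment> \<open>Here \<open>M1\<close> and the continuity of \<open>V\<close> enter: they make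
    the zero set of each vertical section a closed half line or empty.\<close>
  have section_iff: "b x1 \<le> ereal x2 \<longleftrightarrow> H (vector [x1, x2]) = 0"
    if "0 \<le> x1" "0 \<le> x2" for x1 x2
    unfolding b_eq[OF \<open>0 \<le> x1\<close>]
  proof (rule INF_zeros_le_iff)
    show "continuous_on {0..} (\<lambda>x2. H (vector [x1, x2]))"
      using that by (intro continuous_on_compose2[OF H_cont continuous_on_vector_2])
        (auto simp: vector_2_in_quadrant)
  qed (use that M1 in \<open>auto simp: H_nonneg vector_2_in_quadrant\<close>)
  have D_eq: "D = {x \<in> quadrant. b (x $ 1) \<le> ereal (x $ 2)}"
  proof -
    have "x \<in> D \<longleftrightarrow> b (x $ 1) \<le> ereal (x $ 2)" if "x \<in> quadrant" for x
      using that section_iff[of "x $ 1" "x $ 2"] by (simp add: D_iff vector_2_eta quadrant_def)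
    then show ?thesis by (auto simp: D)
  qed
  have "0 \<le> b x1 \<and> b x1 < \<infinity>" if x1: "0 \<le> x1" for x1
  proof
    show "0 \<le> b x1"
      unfolding b_eq[OF x1] by (rule INF_greatest) simp
    \<comment> \<open>By \<open>M2\<close> some real point of the section bounds the infimum from
      above, which excludes \<infinity>.\<close>
    obtain x2 where "0 \<le> x2" "vector [x1, x2] \<in> D"
      using M2[OF x1] by blast
    then have "b x1 \<le> ereal x2"
      unfolding b[OF x1] by (intro INF_lower) simp
    then show "b x1 < \<infinity>"
      by (auto intro: le_less_trans)
  qed
  moreover have "C = {x \<in> quadrant. ereal (x $ 2) < b (x $ 1)}"
    unfolding C_eq D_eq by auto
  \<comment> \<open>A zero of the section at \<open>y\<close> is one at \<open>x\<close>, being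
    squeezed between 0 and \<open>H\<close> at \<open>y\<close>; the larger zero set has the smaller
    infimum. Both directions of monotonicity follow: \<open>x\<close> is the larger abscissa when
    \<open>H\<close> is nonincreasing in it, the smaller one when \<open>H\<close> is
    nondecreasing.\<close>
  moreover have b_le: "b x \<le> b y"
    if "0 \<le> x" "0 \<le> y" "\<And>x2. 0 \<le> x2 \<Longrightarrow> H (vector [x, x2]) \<le> H (vector [y, x2])" for x y
    unfolding b_eq[OF \<open>0 \<le> x\<close>] b_eq[OF \<open>0 \<le> y\<close>]
  proof (rule INF_superset_mono)
    show "{x2. 0 \<le> x2 \<and> H (vector [y, x2]) = 0} \<subseteq> {x2. 0 \<le> x2 \<and> H (vector [x, x2]) = 0}"
      using that by (auto intro!: antisym H_nonneg vector_2_in_quadrant) fastforce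
  qed simp
  have "antimono_on {0..} b" if "\<forall>x2\<ge>0. antimono_on {0..} (\<lambda>x1. H (vector [x1, x2]))"
    using that by (auto simp: monotone_on_def intro!: b_le)
  moreover have "mono_on {0..} b" if "\<forall>x2\<ge>0. mono_on {0..} (\<lambda>x1. H (vector [x1, x2]))"
    using that by (auto simp: monotone_on_def intro!: b_le)
  ultimately show ?thesis
    using D_eq by blast
qed

end
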